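(* Let $f$ be a nonnegative real-valued multiplicative arithmetical function. For each prime $p$ put $\rho(p)=\sup_{\nu\ge 0} f(p^\nu)$, and suppose $\rho(p)<\infty$ for every prime $p$. Suppose that for each prime $p$ there is an exponent $e_p\in\mathbb N$ with $e_p=p^{o(1)}$ (as $p\to\infty$) such that $$\prod_p f(p^{e_p})\,\rho(p)^{-1}\;>\;0,$$ and that the product $$R=\prod_p\Big(1-\frac1p\Big)\rho(p)$$ converges, improper limits being allowed. Then $$\limsup_{n\to\infty}\frac{f(n)}{\log\log n}\;\ge\; e^{\gamma}R,$$ where $\gamma$ is Euler's constant.
   Context: A multiplicative function satisfies $f(1)=1$ and $f(mn)=f(m)f(n)$ for coprime $m,n$; in particular $\rho(p)\ge1$. Products run over all primes in increasing order. Since each factor $f(p^{e_p})\rho(p)^{-1}$ lies in $[0,1]$, the condition $\prod_p f(p^{e_p})\rho(p)^{-1}>0$ means the (monotone) limit of partial products is positive. "Improper limits allowed" means $R$ may be $+\infty$ (or $0$), the inequality then read in $[0,\infty]$. *)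

theory Defs
  imports "HOL-Analysis.Analysis" "HOL-Computational_Algebra.Primes"
begin

text \<open>Arithmetical functions live on the positive integers: the value at 0 is junk.\<close>

definition multiplicative_fun :: "(nat \<Rightarrow> real) \<Rightarrow> bool" where
  "multiplicative_fun f \<longleftrightarrow>
     f 1 = 1 \<and> (\<forall>m n. m > 0 \<longrightarrow> n > 0 \<longrightarrow> coprime m n \<longrightarrow> f (m * n) = f m * f n)"

text \<open>The supremum is a real one, so it is meaningful only for a bounded family; finiteness
  has to be stated separately as \<^const>\<open>bdd_above\<close>.\<close>

definition prime_power_sup :: "(nat \<Rightarrow> real) \<Rightarrow> nat \<Rightarrow> real" where
  "prime_power_sup f p = (SUP \<nu>::nat. f (p ^ \<nu>))"

text \<open>Limit of the products over the primes in increasing order, in the extended reals. In contrast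
  to \<^const>\<open>has_prod\<close> and \<^const>\<open>convergent_prod\<close>, divergence to 0 or to infinity counts as
  (improper) convergence.\<close>

definition has_prime_prod :: "(nat \<Rightarrow> real) \<Rightarrow> ereal \<Rightarrow> bool" where
  "has_prime_prod g L \<longleftrightarrow>
     (\<lambda>x::nat. ereal (\<Prod>p | prime p \<and> p \<le> x. g p)) \<longlonglongrightarrow> L"

text \<open>\<open>e p = p\<^sup>o\<^sup>(\<^sup>1\<^sup>)\<close> as \<open>p\<close> tends to infinity through the primes; values of \<open>\<theta>\<close> off the
  primes are irrelevant.  Since \<^const>\<open>powr\<close> is positive here, \<open>e p = 0\<close> is possible
  for finitely many primes only.\<close>

definition subpolynomial_on_primes :: "(nat \<Rightarrow> nat) \<Rightarrow> bool" where
  "subpolynomial_on_primes e \<longleftrightarrow>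
     (\<exists>\<theta>::nat \<Rightarrow> real. \<theta> \<longlonglongrightarrow> 0 \<and>
        (\<forall>\<^sub>F p in sequentially. prime p \<longrightarrow> real (e p) = real p powr \<theta> p))"

end

theory Submission
  imports Defs "HOL-Real_Asymp.Real_Asymp"
begin

text \<open>
  Fix \<open>y\<close> large, let \<open>a\<^sub>p\<close> for \<open>p \<le> y\<close> be such that \<open>f (p ^ a\<^sub>p)\<close> nearly attains the supremum
  \<open>\<rho>(p)\<close>, let \<open>a\<^sub>p = e\<^sub>p\<close> for \<open>p > y\<close>, and let \<open>n\<^sub>x\<close> be the product of \<open>p ^ a\<^sub>p\<close> over \<open>p \<le> x\<close>.
  The tail of a product with positive limit is close to 1, so \<open>f(n\<^sub>x) \<ge> (1 - \<epsilon>)\<^sup>2 \<Prod>\<^bsub>p \<le> x\<^esub> \<rho>(p)\<close>,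
  while the growth of \<open>e\<^sub>p\<close> gives \<open>ln ln n\<^sub>x \<le> (1 + o(1)) ln x\<close>. It remains to bound
  \<open>\<Prod>\<^bsub>p \<le> x\<^esub> 1 / (1 - 1/p)\<close> from below by \<open>C ln x\<close> for each \<open>C\<close> less than the exponential of
  Euler's constant. As the product \<open>R\<close> converges along all \<open>x\<close>, arbitrarily large \<open>x\<close> suffice,
  and this makes the bound an Abelian statement, without Chebyshev's or Mertens' estimates.
  Otherwise the partial sums of \<open>w\<^sub>p = - ln (1 - 1/p)\<close>, grouped by \<open>m = \<lfloor>ln p\<rfloor>\<close>, eventually stay
  below the harmonic numbers by a fixed \<open>\<eta> > 0\<close>. Partial summation with weights \<open>r ^ m\<close>,
  \<open>r = exp (- s)\<close>, yields
  \<open>1/s \<le> \<zeta>(1 + s) \<le> exp (\<Sum>\<^sub>p w\<^sub>p p powr - s) \<le> exp (- \<eta> + O(1 - r)) / (1 - r)\<close>,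
  which fails as \<open>s\<close> tends to 0.
\<close>

section \<open>Euler products and the series for \<open>zeta(1 + s)\<close>\<close>

text \<open>Half of the Euler product formula, kept finite. By induction on \<open>A\<close>:
  splitting off the power of the new prime \<open>q\<close> bounds the sum by a truncated geometric
  series times the sum for the smaller set. As \<open>g\<close> is nonnegative, both factors may be
  cut off at the same \<open>N\<close>.\<close>

lemma sum_smooth_le_prod:
  fixes g :: "nat \<Rightarrow> real"
  assumes "finite A" and "\<And>p. p \<in> A \<Longrightarrow> prime p"
    and mult: "\<And>m n. g (m * n) = g m * g n" and one: "g 1 = 1" and nonneg: "\<And>n. g n \<ge> 0"
    and "\<And>p. p \<in> A \<Longrightarrow> g p < 1"
  shows "(\<Sum>n | 0 < n \<and> n \<le> N \<and> prime_factors n \<subseteq> A. g n) \<le> (\<Prod>p\<in>A. 1 / (1 - g p))"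
  using assms(1,2,6)
proof (induction A rule: finite_induct)
  case empty
  have "{n. 0 < n \<and> n \<le> N \<and> prime_factors n \<subseteq> {}} \<subseteq> {1}"
    by (auto simp: prime_factorization_empty_iff)
  then have "(\<Sum>n | 0 < n \<and> n \<le> N \<and> prime_factors n \<subseteq> {}. g n) \<le> (\<Sum>n\<in>{1}. g n)"
    by (intro sum_mono2) (auto simp: nonneg)
  then show ?case using one by simp
next
  case (insert q A)
  define T where "T = {n. 0 < n \<and> n \<le> N \<and> prime_factors n \<subseteq> insert q A}"
  define U where "U = {n. 0 < n \<and> n \<le> N \<and> prime_factors n \<subseteq> A}"
  have fin: "finite T" "finite U"
    unfolding T_def U_def by (auto intro: finite_subset[of _ "{..N}"])
  have q: "prime q" and gq: "g q < 1" using insert by auto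
  have gpow: "g (q ^ k) = g q ^ k" for k
    by (induction k) (use one mult in auto)
  \<comment> \<open>The exponent also stays below the cut-off, since
    \<open>k < q ^ k \<le> n \<le> N\<close>. The image may contain numbers above \<open>N\<close>;
    they only enlarge the sum.\<close>
  have "T \<subseteq> (\<lambda>(k,m). q ^ k * m) ` ({..N} \<times> U)"
  proof
    fix n assume n: "n \<in> T"
    then have n0: "n > 0" "n \<le> N" by (auto simp: T_def)
    obtain m where m: "n = q ^ multiplicity q n * m" "\<not> q dvd m"
      using multiplicity_decompose'[of n q] n0 q by (metis neq0_conv not_prime_unit)
    define k where "k = multiplicity q n"
    have m0: "m > 0" using m n0 by (metis mult_0_right neq0_conv)
    have "m dvd n" using m by (metis dvd_triv_right)
    then have mN: "m \<le> N" using n0 by (meson dvd_imp_le le_trans)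
    have "q ^ k \<le> n" using m m0 n0 unfolding k_def by (metis dvd_imp_le dvd_triv_left)
    moreover have "k < q ^ k" using q prime_gt_1_nat by (simp add: power_gt_expt)
    ultimately have kN: "k \<le> N" using n0 by simp
    have "prime_factors m \<subseteq> A"
    proof
      fix p assume p: "p \<in> prime_factors m"
      have "p \<in> prime_factors n"
        using p \<open>m dvd n\<close> n0 by (metis dvd_prime_factors neq0_conv subsetD)
      moreover have "p \<noteq> q" using p m by auto
      ultimately show "p \<in> A" using n by (auto simp: T_def)
    qed
    then have "(k, m) \<in> {..N} \<times> U" using m0 mN kN by (auto simp: U_def)
    then show "n \<in> (\<lambda>(k,m). q ^ k * m) ` ({..N} \<times> U)"
      using m(1) unfolding k_def by (metis (no_types, lifting) case_prod_conv image_eqI)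
  qed
  then have "sum g T \<le> sum g ((\<lambda>(k,m). q ^ k * m) ` ({..N} \<times> U))"
    using fin by (intro sum_mono2) (auto simp: nonneg)
  also have "\<dots> \<le> sum (g \<circ> (\<lambda>(k,m). q ^ k * m)) ({..N} \<times> U)"
    using fin by (intro sum_image_le) (auto simp: nonneg)
  also have "\<dots> = (\<Sum>k\<le>N. g q ^ k) * sum g U"
    by (simp add: sum_product sum.cartesian_product o_def case_prod_beta mult gpow)
  also have "\<dots> \<le> (1 / (1 - g q)) * (\<Prod>p\<in>A. 1 / (1 - g p))"
  proof (rule mult_mono)
    have "(\<Sum>k\<le>N. g q ^ k) = (1 - g q ^ Suc N) / (1 - g q)"
      using gq sum_gp0[of "g q" N] by auto
    also have "\<dots> \<le> 1 / (1 - g q)"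
      using gq nonneg[of q] by (intro divide_right_mono) auto
    finally show "(\<Sum>k\<le>N. g q ^ k) \<le> 1 / (1 - g q)" .
    show "sum g U \<le> (\<Prod>p\<in>A. 1 / (1 - g p))"
      using insert.IH insert.prems unfolding U_def by blast
  qed (use gq in \<open>auto intro: sum_nonneg simp: nonneg\<close>)
  finally show ?case
    unfolding T_def using insert.hyps by simp
qed

text \<open>A telescoping substitute for comparison with an integral: each summand
  \<open>x powr (- (1 + s))\<close> is at least \<open>(x powr - s - (x + 1) powr - s) / s\<close>,
  by \<open>ln (1 + 1/x) \<le> 1/x\<close> and \<open>exp t \<ge> 1 + t\<close>.\<close>

lemma sum_powr_ge:
  fixes s :: real
  assumes "s > 0"
  shows "(1 - real (Suc N) powr - s) / s \<le> (\<Sum>n=1..N. real n powr (- (1 + s)))"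
proof (induction N)
  case 0
  then show ?case by simp
next
  case (Suc N)
  define x where "x = real (Suc N)"
  have x: "x > 0" by (simp add: x_def)
  have "x powr - s * (1 - s / x) \<le> x powr -s * exp (- s * ln (1 + 1 / x))"
  proof (rule mult_left_mono)
    have "ln (1 + 1 / x) \<le> 1 / x" using x by (intro ln_add_one_self_le_self) auto
    then have "1 - s / x \<le> 1 + (- s * ln (1 + 1 / x))"
      using assms mult_left_mono[of "ln (1 + 1/x)" "1/x" s] by auto
    also have "\<dots> \<le> exp (- s * ln (1 + 1 / x))" by (rule exp_ge_add_one_self)
    finally show "1 - s / x \<le> exp (- s * ln (1 + 1 / x))" .
  qed auto
  also have "\<dots> = (x * (1 + 1 / x)) powr - s"
    using x by (subst powr_mult) (auto simp: powr_def add_pos_pos intro!: less_imp_neq[THEN not_sym])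
  also have "x * (1 + 1 / x) = real (Suc (Suc N))"
    using x by (simp add: field_simps x_def)
  finally have "x powr - s - real (Suc (Suc N)) powr - s \<le> s * (x powr -s / x)"
    by (simp add: algebra_simps)
  also have "x powr - s / x = x powr (- (1 + s))"
    using x by (simp add: powr_diff powr_minus divide_simps powr_add)
  finally have "(x powr - s - real (Suc (Suc N)) powr - s) / s \<le> x powr (- (1 + s))"
    using assms by (simp add: field_simps)
  then show ?case using Suc by (simp add: x_def diff_divide_distrib)
qed

text \<open>Concavity of \<open>ln\<close> on the segment from \<open>1 - 1/p\<close> to
  \<open>1\<close>, with weight \<open>q = p powr - s\<close>, gives
  \<open>q * ln (1 - 1/p) \<le> ln (1 - q/p)\<close>. Prime powers are thus covered without an error
  term.\<close>

lemma euler_factor_le: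
  fixes s :: real
  assumes "p \<ge> 2" "s > 0"
  shows "1 / (1 - real p powr (- (1 + s))) \<le> exp (- ln (1 - 1 / real p) * real p powr - s)"
proof -
  define q where "q = real p powr - s"
  define x where "x = 1 / real p"
  have x: "0 < x" "x < 1" using assms by (auto simp: x_def)
  have "q \<le> real p powr 0" unfolding q_def using assms by (intro powr_mono) auto
  then have q: "0 \<le> q" "q \<le> 1" using assms by (auto simp: q_def)
  have qx: "real p powr (- (1 + s)) = q * x"
    using assms by (simp add: q_def x_def powr_diff powr_minus divide_simps powr_add)
  have "q * x \<le> 1 * x" using q x by (intro mult_right_mono) auto
  then have pos: "1 - q * x > 0" using x by linarith
  have "q * ln (1 - x) + (1 - q) * ln 1 \<le> ln (q * (1 - x) + (1 - q) * 1)"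
    using concave_onD[OF ln_concave, of "1 - q" "1 - x" 1] q x by simp
  then have "q * ln (1 - x) \<le> ln (1 - q * x)" by (simp add: algebra_simps)
  then have "exp (- ln (1 - q * x)) \<le> exp (- ln (1 - x) * q)" by (simp add: mult.commute)
  also have "exp (- ln (1 - q * x)) = 1 / (1 - q * x)"
    using pos by (simp add: exp_minus field_simps)
  finally show ?thesis
    unfolding qx unfolding q_def x_def .
qed

text \<open>Every \<open>n \<le> N\<close> has only prime factors up to \<open>N\<close>, so the
  truncated series is dominated by a finite Euler product, whose factors are then compared one by
  one.\<close>

lemma sum_powr_le_exp_prime_sum:
  fixes s :: real
  assumes "s > 0"
  shows "(\<Sum>n=1..N. real n powr (- (1 + s)))
    \<le> exp (\<Sum>p | prime p \<and> p \<le> N. - ln (1 - 1 / real p) * real p powr - s)"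
proof -
  define A where "A = {p::nat. prime p \<and> p \<le> N}"
  have A: "finite A" "\<And>p. p \<in> A \<Longrightarrow> prime p" by (auto simp: A_def)
  have lt1: "real p powr (- (1 + s)) < 1" if "p \<in> A" for p
    using that assms powr_less_mono[of "-(1+s)" 0 "real p"] prime_gt_1_nat[of p] by (auto simp: A_def)
  have "{1..N} = {n. 0 < n \<and> n \<le> N \<and> prime_factors n \<subseteq> A}"
    by (auto simp: A_def in_prime_factors_iff dest!: dvd_imp_le)
  then have "(\<Sum>n=1..N. real n powr (- (1 + s)))
      = (\<Sum>n | 0 < n \<and> n \<le> N \<and> prime_factors n \<subseteq> A. real n powr (- (1 + s)))" by simp
  also have "\<dots> \<le> (\<Prod>p\<in>A. 1 / (1 - real p powr (- (1 + s))))"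
    using A lt1 by (intro sum_smooth_le_prod) (auto simp: powr_mult)
  also have "\<dots> \<le> (\<Prod>p\<in>A. exp (- ln (1 - 1 / real p) * real p powr - s))"
  proof (rule prod_mono)
    fix p assume p: "p \<in> A"
    have "2 \<le> p" using p A prime_ge_2_nat by blast
    then show "0 \<le> 1 / (1 - real p powr (- (1 + s))) \<and>
      1 / (1 - real p powr (- (1 + s))) \<le> exp (- ln (1 - 1 / real p) * real p powr - s)"
      using lt1[OF p] euler_factor_le[OF _ assms, of p] by auto
  qed
  also have "\<dots> = exp (\<Sum>p\<in>A. - ln (1 - 1 / real p) * real p powr - s)"
    by (rule exp_sum[symmetric]) (rule A(1))
  finally show ?thesis by (simp add: A_def)
qed

section \<open>Abelian summation and the lower bound for the product over primes\<close>

text \<open>Summation by parts makes the left side an average of the partial sums of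
  \<open>d\<close>, with weights \<open>(1 - r) * r ^ m\<close> for \<open>m < M\<close> and
  \<open>r ^ M\<close>, of total 1. All partial sums count as \<open>- \<eta>\<close>, except that
  each of the first \<open>k\<close> may exceed it by \<open>K\<close>, at a cost of at most
  \<open>(1 - r) * K\<close>.\<close>

lemma abel_weighted_sum_le:
  fixes d :: "nat \<Rightarrow> real"
  assumes r: "0 \<le> r" "r \<le> 1" and K: "K \<ge> 0"
    and small: "\<And>m. m < k \<Longrightarrow> sum d {..m} \<le> K - \<eta>"
    and large: "\<And>m. m \<ge> k \<Longrightarrow> sum d {..m} \<le> - \<eta>" and "k \<le> M"
  shows "(\<Sum>m\<le>M. d m * r ^ m) \<le> - \<eta> + (1 - r) * (K * k)"
proof -
  have parts: "(\<Sum>m\<le>M. d m * r ^ m) = (1 - r) * (\<Sum>m<M. sum d {..m} * r ^ m) + sum d {..M} * r ^ M" for M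
    by (induction M) (auto simp: algebra_simps)
  have geo: "(1 - r) * (\<Sum>m<M. r ^ m) + r ^ M = 1"
    using one_diff_power_eq[of r M] by simp
  have "(\<Sum>m<M. sum d {..m} * r ^ m) \<le> (\<Sum>m<M. (if m < k then K else 0) - \<eta> * r ^ m)"
  proof (rule sum_mono)
    fix m
    have rm: "0 \<le> r ^ m" "r ^ m \<le> 1" using r by (auto intro: power_le_one)
    have "sum d {..m} * r ^ m \<le> ((if m < k then K else 0) - \<eta>) * r ^ m"
      using rm small[of m] large[of m] by (intro mult_right_mono) auto
    also have "\<dots> \<le> (if m < k then K else 0) - \<eta> * r ^ m"
      using rm K by (auto simp: algebra_simps mult_left_le)
    finally show "sum d {..m} * r ^ m \<le> (if m < k then K else 0) - \<eta> * r ^ m" .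
  qed
  also have "\<dots> = K * k - \<eta> * (\<Sum>m<M. r ^ m)"
  proof -
    have "(\<Sum>m<M. if m < k then K else 0) = (\<Sum>m\<in>{..<M} \<inter> {m. m < k}. K)"
      by (simp add: sum.If_cases)
    also have "{..<M} \<inter> {m. m < k} = {..<k}" using \<open>k \<le> M\<close> by auto
    finally show ?thesis by (simp add: sum_subtractf sum_distrib_left mult.commute)
  qed
  finally have "(1 - r) * (\<Sum>m<M. sum d {..m} * r ^ m) \<le> (1 - r) * (K * k - \<eta> * (\<Sum>m<M. r ^ m))"
    using r by (intro mult_left_mono) auto
  moreover have "sum d {..M} * r ^ M \<le> - \<eta> * r ^ M"
    using r large[OF \<open>k \<le> M\<close>] by (intro mult_right_mono) auto
  ultimately have "(\<Sum>m\<le>M. d m * r ^ m) \<le> (1 - r) * (K * k) - \<eta> * ((1 - r) * (\<Sum>m<M. r ^ m) + r ^ M)"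
    unfolding parts by (simp add: algebra_simps)
  then show ?thesis by (simp add: geo)
qed

lemma sum_power_div_le_ln:
  fixes r :: real
  assumes "0 \<le> r" "r < 1"
  shows "(\<Sum>m\<le>M. r ^ m / real m) \<le> - ln (1 - r)"
proof -
  \<comment> \<open>The term at 0 vanishes, because division by 0 yields 0.\<close>
  have s: "(\<lambda>n. r ^ n / real n) sums - ln (1 - r)"
    using sums_minus[OF ln_series'[of "- r"]] assms by simp
  have "(\<Sum>m\<in>{..M}. r ^ m / real m) \<le> (\<Sum>n. r ^ n / real n)"
    using s assms by (intro sum_le_suminf) (auto simp: sums_iff)
  with s show ?thesis by (simp add: sums_iff)
qed

text \<open>The lower half of Mertens' third theorem, along arbitrarily large \<open>x\<close> only.
  Its negation is an upper bound at all large \<open>x\<close>, which is what summation by parts can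
  exploit.\<close>

lemma frequently_prime_prod_gt:
  assumes "C < exp euler_mascheroni"
  shows "\<exists>\<^sub>F x in sequentially.
    C * ln (real x) < (\<Prod>p | prime p \<and> p \<le> x. 1 / (1 - 1 / real p))"
proof (rule ccontr)
  assume "\<not> ?thesis"
  then have "\<forall>\<^sub>F x in sequentially. (\<Prod>p | prime p \<and> p \<le> x. 1 / (1 - 1 / real p)) \<le> C * ln (real x)"
    by (simp add: not_frequently not_less)
  then obtain x0 where x0: "\<And>x. x \<ge> x0 \<Longrightarrow> (\<Prod>p | prime p \<and> p \<le> x. 1 / (1 - 1 / real p)) \<le> C * ln (real x)"
    unfolding eventually_sequentially by blast
  define w where "w = (\<lambda>p::nat. - ln (1 - 1 / real p))"
  have p1: "1 / real p < 1" if "prime p" for p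
    using prime_gt_1_nat[OF that] by simp
  have w_nonneg: "w p \<ge> 0" if "prime p" for p
    using p1[OF that] by (simp add: w_def)
  have prod_pos: "(\<Prod>p | prime p \<and> p \<le> x. 1 / (1 - 1 / real p)) > 0" for x
    using p1 by (intro prod_pos) auto
  have ln_prod: "ln (\<Prod>p | prime p \<and> p \<le> x. 1 / (1 - 1 / real p)) = (\<Sum>p | prime p \<and> p \<le> x. w p)" for x
    using p1 by (subst ln_prod) (auto simp: w_def ln_div intro!: sum.cong)
  \<comment> \<open>Positivity of \<open>C\<close> comes from the negated claim, as the product is
    positive; it makes \<open>ln C\<close> meaningful.\<close>
  have "0 < C * ln (real (max 2 x0))"
    using prod_pos[of "max 2 x0"] x0[of "max 2 x0"] by simp
  then have "C > 0" by (simp add: zero_less_mult_iff)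
  define c where "c = ln C"
  have "c < euler_mascheroni"
    using assms \<open>C > 0\<close> unfolding c_def by (metis exp_gt_zero ln_exp ln_less_cancel_iff)
  have prime_sum_le: "(\<Sum>p | prime p \<and> p \<le> x. w p) \<le> c + ln (ln (real x))"
    if "x \<ge> x0" "x \<ge> 2" for x
  proof -
    have "(\<Sum>p | prime p \<and> p \<le> x. w p) \<le> ln (C * ln (real x))"
      using ln_mono[OF x0[OF that(1)] prod_pos] by (simp add: ln_prod)
    then show ?thesis using that \<open>C > 0\<close> by (simp add: ln_mult c_def)
  qed

  \<comment> \<open>On this logarithmic scale \<open>p powr - s \<le> r ^ k p\<close> for
    \<open>r = exp (- s)\<close>, and \<open>y m\<close> bounds all primes of the blocks
    \<open>0\<close> to \<open>m\<close> while \<open>ln (ln (y m)) \<le> ln (m + 1)\<close>, which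
    is comparable with \<open>harm m\<close>.\<close>
  define k where "k = (\<lambda>p::nat. nat \<lfloor>ln (real p)\<rfloor>)"
  define y where "y = (\<lambda>m::nat. nat \<lfloor>exp (real m + 1)\<rfloor>)"
  have k_le: "real (k p) \<le> ln (real p)" if "p > 0" for p
    using that by (simp add: k_def)
  have le_y: "p \<le> y m" if "k p \<le> m" "prime p" for p m
  proof -
    have "p > 0" using that prime_gt_0_nat by blast
    have "ln (real p) < real m + 1"
      using that(1) unfolding k_def by linarith
    then have "real p \<le> exp (real m + 1)"
      using \<open>p > 0\<close> by (metis exp_le_cancel_iff exp_ln less_imp_le of_nat_0_less_iff)
    then show ?thesis unfolding y_def by (simp add: le_nat_floor)
  qed
  have y_ge: "Suc m \<le> y m" for m
    using exp_ge_add_one_self[of "real m + 1"] unfolding y_def by (intro le_nat_floor) auto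
  have fin: "finite {p. prime p \<and> k p \<le> m}" for m
    by (rule finite_subset[of _ "{..y m}"]) (auto intro: le_y)
  define W where "W = (\<lambda>m. \<Sum>p | prime p \<and> k p = m. w p)"
  have sum_W: "(\<Sum>m\<le>M. W m * h m) = (\<Sum>p | prime p \<and> k p \<le> M. w p * h (k p))" for M and h :: "nat \<Rightarrow> real"
  proof -
    have "(\<Sum>m\<le>M. W m * h m) = (\<Sum>m\<le>M. \<Sum>p\<in>{p \<in> {p. prime p \<and> k p \<le> M}. k p = m}. w p * h (k p))"
      unfolding W_def sum_distrib_right by (intro sum.cong refl) auto
    also have "\<dots> = (\<Sum>p | prime p \<and> k p \<le> M. w p * h (k p))"
      by (rule sum.group) (use fin in auto)
    finally show ?thesis .
  qed

  \<comment> \<open>With \<open>1 / 0 = 0\<close>, \<open>d 0\<close> is just \<open>W 0\<close>,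
    and the subtracted terms add up to \<open>harm m\<close>.\<close>
  define d where "d = (\<lambda>m. W m - 1 / real m)"
  have harm: "(\<Sum>j\<le>m. 1 / real j) = harm m" for m
    by (induction m) (auto simp: harm_Suc harm_def inverse_eq_divide)
  have sum_d: "sum d {..m} \<le> c + ln (real m + 1) - harm m" if "m \<ge> max 1 x0" for m
  proof -
    have y: "y m \<ge> x0" "y m \<ge> 2" "y m > 0" using y_ge[of m] that by auto
    have "sum W {..m} = (\<Sum>p | prime p \<and> k p \<le> m. w p)"
      using sum_W[where h = "\<lambda>_. 1"] by simp
    also have "\<dots> \<le> (\<Sum>p | prime p \<and> p \<le> y m. w p)"
      using le_y by (intro sum_mono2) (auto intro: w_nonneg)
    also have "\<dots> \<le> c + ln (ln (real (y m)))" by (rule prime_sum_le) fact+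
    also have "ln (ln (real (y m))) \<le> ln (real m + 1)"
    proof (rule ln_mono)
      have "real (y m) \<le> exp (real m + 1)" by (simp add: y_def)
      then show "ln (real (y m)) \<le> real m + 1" using y ln_mono[of "real (y m)"] by fastforce
      show "0 < ln (real (y m))" using y by simp
    qed
    finally show ?thesis unfolding d_def by (simp add: sum_subtractf harm)
  qed

  \<comment> \<open>The upper bound for the partial sums of \<open>d\<close> tends to
    \<open>c - euler_mascheroni = - 2 * \<eta>\<close>, so it eventually lies below
    \<open>- \<eta>\<close>.\<close>
  define \<eta> where "\<eta> = (euler_mascheroni - c) / 2"
  have "\<eta> > 0" using \<open>c < euler_mascheroni\<close> by (simp add: \<eta>_def)
  have "(\<lambda>m. c + (ln (real m + 1) - ln (real m)) - (harm m - ln (real m))) \<longlonglongrightarrow> c + 0 - euler_mascheroni"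
    by (intro tendsto_intros euler_mascheroni_LIMSEQ) real_asymp
  then have "\<forall>\<^sub>F m in sequentially. c + (ln (real m + 1) - ln (real m)) - (harm m - ln (real m)) < - \<eta>"
    by (rule order_tendstoD(2)) (use \<open>c < euler_mascheroni\<close> in \<open>simp add: \<eta>_def field_simps\<close>)
  then have "\<forall>\<^sub>F m in sequentially. sum d {..m} \<le> - \<eta>"
    using eventually_ge_at_top[of "max 1 x0"] by eventually_elim (use sum_d in force)
  then obtain k0 where k0: "\<And>m. m \<ge> k0 \<Longrightarrow> sum d {..m} \<le> - \<eta>"
    unfolding eventually_sequentially by blast
  \<comment> \<open>A crude constant absorbing the finitely many partial sums before
    \<open>k0\<close>.\<close>
  define K where "K = (\<Sum>m<k0. \<bar>sum d {..m} + \<eta>\<bar>)"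
  have "K \<ge> 0" by (simp add: K_def sum_nonneg)
  have K: "sum d {..m} \<le> K - \<eta>" if "m < k0" for m
    using member_le_sum[of m "{..<k0}" "\<lambda>m. \<bar>sum d {..m} + \<eta>\<bar>"] that unfolding K_def by simp

  have bound: "(1 - real (Suc N) powr - s) / s \<le> exp (- \<eta> + (1 - exp (- s)) * (K * k0)) / (1 - exp (- s))"
    if "s > 0" for s N
  proof -
    define r where "r = exp (- s)"
    have r: "0 < r" "r < 1" using that by (auto simp: r_def)
    \<comment> \<open>Large enough to complete the blocks met by the primes up to \<open>N\<close>,
      and at least \<open>k0\<close> for the Abelian bound. The final estimate depends on neither
      \<open>M\<close> nor \<open>N\<close>.\<close>
    define M where "M = max k0 (k N)"
    have kM: "k p \<le> M" if "prime p" "p \<le> N" for p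
    proof -
      have "ln (real p) \<le> ln (real N)" using that prime_gt_0_nat[of p] by simp
      then have "k p \<le> k N" unfolding k_def by (intro nat_mono floor_mono)
      then show ?thesis by (simp add: M_def)
    qed
    have "(\<Sum>p | prime p \<and> p \<le> N. w p * real p powr - s) \<le> (\<Sum>p | prime p \<and> p \<le> N. w p * r ^ k p)"
    proof (intro sum_mono mult_left_mono)
      fix p assume "p \<in> {p. prime p \<and> p \<le> N}"
      then have p: "prime p" "p > 0" using prime_gt_0_nat by auto
      have "s * real (k p) \<le> s * ln (real p)" using k_le[OF p(2)] that by (intro mult_left_mono) auto
      then have "real p powr - s \<le> exp (real (k p) * - s)"
        using p by (simp add: powr_def mult.commute)
      then show "real p powr - s \<le> r ^ k p" unfolding r_def exp_of_nat_mult .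
    qed (auto intro: w_nonneg)
    also have "\<dots> \<le> (\<Sum>p | prime p \<and> k p \<le> M. w p * r ^ k p)"
      using kM r fin by (intro sum_mono2) (auto intro!: mult_nonneg_nonneg w_nonneg)
    also have "\<dots> = (\<Sum>m\<le>M. W m * r ^ m)" by (rule sum_W[symmetric])
    also have "\<dots> = (\<Sum>m\<le>M. d m * r ^ m) + (\<Sum>m\<le>M. r ^ m / real m)"
      by (simp add: d_def algebra_simps flip: sum.distrib)
    also have "\<dots> \<le> (- \<eta> + (1 - r) * (K * k0)) + - ln (1 - r)"
      using r K k0 \<open>K \<ge> 0\<close>
      by (intro add_mono abel_weighted_sum_le sum_power_div_le_ln) (auto simp: M_def)
    finally have "exp (\<Sum>p | prime p \<and> p \<le> N. w p * real p powr - s)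
        \<le> exp (- \<eta> + (1 - r) * (K * k0) - ln (1 - r))" by simp
    also have "\<dots> = exp (- \<eta> + (1 - r) * (K * k0)) / (1 - r)"
      using r by (simp add: exp_diff)
    finally show ?thesis
      using sum_powr_ge[OF that, of N] sum_powr_le_exp_prime_sum[OF that, of N]
      unfolding w_def r_def by linarith
  qed
  \<comment> \<open>First \<open>N\<close> tends to infinity with \<open>s\<close> fixed.\<close>
  have bound': "(1 - exp (- s)) / s \<le> exp (- \<eta> + (1 - exp (- s)) * (K * k0))" if "s > 0" for s
  proof -
    have "(\<lambda>N. (1 - real (Suc N) powr - s) / s) \<longlonglongrightarrow> (1 - 0) / s"
      using that by (intro tendsto_intros) (real_asymp, simp)
    then have "(1 - 0) / s \<le> exp (- \<eta> + (1 - exp (- s)) * (K * k0)) / (1 - exp (- s))"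
      by (rule tendsto_upperbound) (use bound[OF that] in auto)
    then show ?thesis using that by (simp add: field_simps)
  qed
  \<comment> \<open>Now \<open>s\<close> tends to 0 from the right: the poles \<open>1/s\<close> and
    \<open>1 / (1 - exp (- s))\<close> cancel, leaving
    \<open>1 \<le> exp (- \<eta>)\<close>.\<close>
  have "((\<lambda>s::real. (1 - exp (- s)) / s) \<longlongrightarrow> 1) (at_right 0)" by real_asymp
  moreover have "((\<lambda>s::real. exp (- \<eta> + (1 - exp (- s)) * (K * k0))) \<longlongrightarrow>
      exp (- \<eta> + (1 - exp (- 0)) * (K * k0))) (at_right 0)"
    by (intro tendsto_intros)
  moreover have "\<forall>\<^sub>F s::real in at_right 0.
      (1 - exp (- s)) / s \<le> exp (- \<eta> + (1 - exp (- s)) * (K * k0))"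
    using eventually_at_right_less[of 0] by eventually_elim (rule bound')
  ultimately have "1 \<le> exp (- \<eta> + (1 - exp (- 0)) * (K * k0))"
    by (intro tendsto_le[OF trivial_limit_at_right_real])
  then show False using \<open>\<eta> > 0\<close> by simp
qed

section \<open>Integers at which \<open>f\<close> is nearly extremal\<close>

lemma multiplicative_fun_prod_prime_powers:
  assumes "multiplicative_fun f" "finite A" "\<And>p. p \<in> A \<Longrightarrow> prime p"
  shows "f (\<Prod>p\<in>A. p ^ a p) = (\<Prod>p\<in>A. f (p ^ a p))"
  using assms(2,3)
proof (induction A rule: finite_induct)
  case empty
  then show ?case using assms(1) by (simp add: multiplicative_fun_def)
next
  case (insert q A)
  have "coprime (q ^ a q) (\<Prod>p\<in>A. p ^ a p)"
  proof (rule prod_coprime_right)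
    fix p assume "p \<in> A"
    then have "coprime q p" using insert.prems insert.hyps by (intro primes_coprime) auto
    then show "coprime (q ^ a q) (p ^ a p)" by simp
  qed
  moreover have "q ^ a q > 0" "(\<Prod>p\<in>A. p ^ a p) > 0"
    using insert.prems by (auto simp: prime_gt_0_nat intro: prod_pos)
  ultimately have "f (q ^ a q * (\<Prod>p\<in>A. p ^ a p)) = f (q ^ a q) * f (\<Prod>p\<in>A. p ^ a p)"
    using assms(1) unfolding multiplicative_fun_def by blast
  then show ?case using insert by simp
qed

lemma prime_power_sup_ge:
  assumes "bdd_above (range (\<lambda>\<nu>::nat. f (p ^ \<nu>)))"
  shows "f (p ^ \<nu>) \<le> prime_power_sup f p"
  unfolding prime_power_sup_def using assms by (rule cSUP_upper2[OF _ UNIV_I order_refl])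

text \<open>The suprema need not be attained, so each prime loses a factor
  \<open>t = 1 - \<epsilon> / (card A + 1)\<close>; Bernoulli's inequality keeps the total loss
  within \<open>1 - \<epsilon>\<close>. The added 1 keeps \<open>t < 1\<close> for empty
  \<open>A\<close>.\<close>

lemma exists_exponents_near_sup:
  assumes "finite A" and "0 < \<epsilon>" "\<epsilon> < 1"
    and pos: "\<And>p. p \<in> A \<Longrightarrow> prime_power_sup f p > 0"
  shows "\<exists>\<nu>. (1 - \<epsilon>) * (\<Prod>p\<in>A. prime_power_sup f p) \<le> (\<Prod>p\<in>A. f (p ^ \<nu> p))"
proof -
  define t where "t = 1 - \<epsilon> / (card A + 1)"
  have "\<epsilon> / (card A + 1) < 1" "\<epsilon> / (card A + 1) > 0" using assms by (auto simp: field_simps)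
  then have t: "0 < t" "t < 1" by (auto simp: t_def)
  have "\<exists>\<nu>::nat. t * prime_power_sup f p < f (p ^ \<nu>)" if "p \<in> A" for p
  proof (rule ccontr)
    assume "\<not> ?thesis"
    then have "(SUP \<nu>::nat. f (p ^ \<nu>)) \<le> t * prime_power_sup f p"
      by (intro cSUP_least) (auto simp: not_less)
    then show False using pos[OF that] t by (simp flip: prime_power_sup_def)
  qed
  then obtain \<nu> where \<nu>: "\<And>p. p \<in> A \<Longrightarrow> t * prime_power_sup f p < f (p ^ \<nu> p)"
    by metis
  have "1 + real (card A) * (- (\<epsilon> / (card A + 1))) \<le> (1 + - (\<epsilon> / (card A + 1))) ^ card A"
    by (rule Bernoulli_inequality) (use t in \<open>simp add: t_def\<close>)
  moreover have "\<epsilon> * (card A / (card A + 1)) \<le> \<epsilon> * 1"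
    using assms by (intro mult_left_mono) auto
  ultimately have "1 - \<epsilon> \<le> t ^ card A"
    by (simp add: t_def mult.commute)
  then have "(1 - \<epsilon>) * (\<Prod>p\<in>A. prime_power_sup f p) \<le> t ^ card A * (\<Prod>p\<in>A. prime_power_sup f p)"
    using pos by (intro mult_right_mono prod_nonneg) (auto simp: less_imp_le)
  also have "\<dots> = (\<Prod>p\<in>A. t * prime_power_sup f p)" by (simp add: prod.distrib)
  also have "\<dots> \<le> (\<Prod>p\<in>A. f (p ^ \<nu> p))"
    using \<nu> pos t by (intro prod_mono) (auto simp: less_imp_le)
  finally show ?thesis by blast
qed

text \<open>The upper bound controls the size of the constructed integers; positivity of
  \<open>e p\<close> lets large primes divide them, so that they tend to infinity.\<close>

lemma subpolynomial_on_primesD: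
  assumes "subpolynomial_on_primes e" "\<delta> > 0"
  shows "\<exists>p0. \<forall>p\<ge>p0. prime p \<longrightarrow> 0 < e p \<and> real (e p) \<le> real p powr \<delta>"
proof -
  obtain \<theta> where \<theta>: "\<theta> \<longlonglongrightarrow> 0" "\<forall>\<^sub>F p in sequentially. prime p \<longrightarrow> real (e p) = real p powr \<theta> p"
    using assms(1) unfolding subpolynomial_on_primes_def by blast
  have "\<forall>\<^sub>F p in sequentially. \<theta> p < \<delta>" using \<theta>(1) assms(2) by (rule order_tendstoD)
  with \<theta>(2) have "\<forall>\<^sub>F p in sequentially. prime p \<longrightarrow> 0 < e p \<and> real (e p) \<le> real p powr \<delta>"
  proof eventually_elim
    case (elim p)
    show ?case
    proof
      assume p: "prime p"
      then have "p > 1" by (rule prime_gt_1_nat)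
      then have "0 < real p powr \<theta> p" "real p powr \<theta> p \<le> real p powr \<delta>"
        using elim by (auto intro: powr_mono)
      moreover have "real (e p) = real p powr \<theta> p" using elim p by blast
      ultimately show "0 < e p \<and> real (e p) \<le> real p powr \<delta>"
        by (metis of_nat_0_less_iff)
    qed
  qed
  then show ?thesis by (simp add: eventually_sequentially)
qed

text \<open>The trivial count of at most \<open>x\<close> primes suffices, because constants and
  logarithms disappear under the second \<open>ln\<close>: one \<open>\<delta>\<close> comes from
  the exponents, the other absorbs \<open>K * ln x\<close>. Divergence of the product makes the
  inner logarithm positive, as monotonicity of the outer one requires.\<close>

lemma ln_ln_prod_prime_powers_le:
  fixes a :: "nat \<Rightarrow> nat" and K \<delta> :: real
  assumes a: "\<And>p. prime p \<Longrightarrow> real (a p) \<le> K * real p powr \<delta>" and "K > 0" "\<delta> > 0"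
    and top: "filterlim (\<lambda>x. \<Prod>p | prime p \<and> p \<le> x. p ^ a p) at_top sequentially"
  shows "\<forall>\<^sub>F x in sequentially.
    ln (ln (real (\<Prod>p | prime p \<and> p \<le> x. p ^ a p))) \<le> (1 + 2 * \<delta>) * ln (real x)"
proof -
  have "\<forall>\<^sub>F x::nat in sequentially. real x * (K * real x powr \<delta> * ln (real x)) \<le> real x powr (1 + 2 * \<delta>)"
    using assms(2,3) by real_asymp
  moreover have "\<forall>\<^sub>F x in sequentially. 2 \<le> (\<Prod>p | prime p \<and> p \<le> x. p ^ a p)"
    using top by (auto simp: filterlim_at_top)
  ultimately show ?thesis using eventually_ge_at_top[of 1]
  proof eventually_elim
    case (elim x)
    let ?A = "{p. prime p \<and> p \<le> x}"
    have "ln (real (\<Prod>p\<in>?A. p ^ a p)) = (\<Sum>p\<in>?A. real (a p) * ln (real p))"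
      unfolding of_nat_prod
      by (subst ln_prod) (auto simp: ln_realpow prime_gt_0_nat intro!: sum.cong)
    also have "\<dots> \<le> (\<Sum>p\<in>?A. K * real x powr \<delta> * ln (real x))"
    proof (rule sum_mono)
      fix p assume "p \<in> ?A"
      then have p: "prime p" "1 \<le> p" "p \<le> x" using prime_ge_1_nat by auto
      have "real (a p) \<le> K * real x powr \<delta>"
        using a[OF p(1)] p assms(2,3)
        by (elim order_trans) (auto intro!: mult_left_mono powr_mono2)
      then show "real (a p) * ln (real p) \<le> K * real x powr \<delta> * ln (real x)"
        using p assms(2) by (intro mult_mono) auto
    qed
    also have "\<dots> = card ?A * (K * real x powr \<delta> * ln (real x))" by simp
    also have "\<dots> \<le> real x * (K * real x powr \<delta> * ln (real x))"
    proof (rule mult_right_mono)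
      have "card ?A \<le> card {1..x}" by (intro card_mono) (auto dest: prime_ge_1_nat)
      then show "real (card ?A) \<le> real x" by simp
    qed (use elim assms(2) in auto)
    also have "\<dots> \<le> real x powr (1 + 2 * \<delta>)" using elim by simp
    finally have "ln (real (\<Prod>p\<in>?A. p ^ a p)) \<le> real x powr (1 + 2 * \<delta>)" .
    moreover have "ln (real (\<Prod>p\<in>?A. p ^ a p)) > 0" using elim(2) by (intro ln_gt_zero) linarith
    ultimately have "ln (ln (real (\<Prod>p\<in>?A. p ^ a p))) \<le> ln (real x powr (1 + 2 * \<delta>))"
      by (rule ln_mono)
    then show ?case by (simp add: ln_powr)
  qed
qed

text \<open>One factor \<open>1 - \<epsilon>\<close> is lost on the primes up to a fixed
  \<open>y\<close>, where near-optimal exponents are chosen, the other on the tail, where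
  \<open>e\<close> is used. Since \<open>y\<close> does not depend on \<open>x\<close>, the
  uncontrolled exponents are finitely many and do not affect the growth.\<close>

lemma exists_near_extremal_sequence:
  fixes f :: "nat \<Rightarrow> real" and e :: "nat \<Rightarrow> nat" and L :: ereal
  assumes mult: "multiplicative_fun f"
    and nonneg: "\<And>n. n > 0 \<Longrightarrow> f n \<ge> 0"
    and bdd: "\<And>p. prime p \<Longrightarrow> bdd_above (range (\<lambda>\<nu>::nat. f (p ^ \<nu>)))"
    and e: "subpolynomial_on_primes e"
    and L: "L > 0" "has_prime_prod (\<lambda>p. f (p ^ e p) * inverse (prime_power_sup f p)) L"
    and \<epsilon>: "0 < \<epsilon>" "\<epsilon> < 1" and \<delta>: "\<delta> > 0"
  shows "\<exists>n::nat \<Rightarrow> nat. filterlim n at_top sequentially \<and>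
    (\<forall>\<^sub>F x in sequentially. (1 - \<epsilon>)\<^sup>2 * (\<Prod>p | prime p \<and> p \<le> x. prime_power_sup f p) \<le> f (n x)) \<and>
    (\<forall>\<^sub>F x in sequentially. ln (ln (real (n x))) \<le> (1 + 2 * \<delta>) * ln (real x))"
proof -
  define \<rho> where "\<rho> = prime_power_sup f"
  define P where "P = (\<lambda>x::nat. {p. prime p \<and> p \<le> x})"
  have fin [simp]: "finite (P x)" for x by (auto simp: P_def)
  define g where "g = (\<lambda>p. f (p ^ e p) * inverse (\<rho> p))"
  have \<rho>_ge: "f (p ^ k) \<le> \<rho> p" if "prime p" for p k
    unfolding \<rho>_def by (rule prime_power_sup_ge) (rule bdd[OF that])
  \<comment> \<open>The exponent 0 contributes \<open>f 1 = 1\<close>.\<close>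
  have \<rho>1: "\<rho> p \<ge> 1" if "prime p" for p
    using \<rho>_ge[OF that, of 0] mult by (simp add: multiplicative_fun_def)
  have \<rho>0: "\<rho> p \<ge> 0" if "prime p" for p
    using \<rho>1[OF that] by simp
  have g: "0 \<le> g p" "g p \<le> 1" if "prime p" for p
  proof -
    show "0 \<le> g p" using nonneg[of "p ^ e p"] \<rho>1[OF that] prime_gt_0_nat[OF that] by (simp add: g_def)
    show "g p \<le> 1" using \<rho>_ge[OF that, of "e p"] \<rho>1[OF that] by (simp add: g_def field_simps)
  qed
  define G where "G = (\<lambda>x. \<Prod>p\<in>P x. g p)"
  have G01: "0 \<le> G x" "G x \<le> 1" for x
    unfolding G_def using g by (auto simp: P_def intro!: prod_nonneg prod_le_1)
  have split: "(\<Prod>p\<in>P y. h p) = (\<Prod>p\<in>P x. h p) * (\<Prod>p\<in>P y - P x. h p)" if "x \<le> y" for x y and h :: "nat \<Rightarrow> real"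
    using that by (subst prod.subset_diff[of "P x" "P y"]) (auto simp: P_def)
  have "decseq G"
    unfolding decseq_def
  proof (intro allI impI)
    fix x y assume "x \<le> (y::nat)"
    have "(\<Prod>p\<in>P y - P x. g p) \<le> 1" using g by (intro prod_le_1) (auto simp: P_def)
    then show "G y \<le> G x"
      using G01(1)[of x] split[OF \<open>x \<le> y\<close>, of g] by (simp add: G_def mult_left_le)
  qed
  have lim: "(\<lambda>x. ereal (G x)) \<longlonglongrightarrow> L"
    using L(2) by (simp add: has_prime_prod_def G_def P_def g_def \<rho>_def)
  \<comment> \<open>This excludes an infinite limit, so \<open>L\<close> is a positive real
    \<open>l\<close>.\<close>
  have "L \<le> 1" using lim by (rule LIMSEQ_le_const2) (use G01 in auto)
  with L(1) obtain l where l: "L = ereal l" "l > 0" by (cases L) auto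
  have lim': "G \<longlonglongrightarrow> l" using lim l by simp
  have G_ge: "l \<le> G x" for x by (rule decseq_ge[OF \<open>decseq G\<close> lim'])
  \<comment> \<open>Choice of \<open>y\<close>: the products \<open>G\<close> decrease to
    \<open>l\<close>, so once \<open>G y < l / (1 - \<epsilon>)\<close>, every quotient
    \<open>G x / G y\<close> with \<open>x \<ge> y\<close> is at least
    \<open>l / G y > 1 - \<epsilon>\<close>.\<close>
  have "l < l / (1 - \<epsilon>)" using l \<epsilon> by (simp add: field_simps)
  then obtain y where y: "G y < l / (1 - \<epsilon>)"
    using order_tendstoD(2)[OF lim'] by (auto simp: eventually_sequentially)
  have tail: "1 - \<epsilon> \<le> (\<Prod>p\<in>P x - P y. g p)" if "y \<le> x" for x
  proof -
    have "(1 - \<epsilon>) * G y \<le> l" using y \<epsilon> by (simp add: field_simps)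
    also have "l \<le> G y * (\<Prod>p\<in>P x - P y. g p)"
      using G_ge[of x] split[OF that, of g] by (simp add: G_def)
    finally show ?thesis using G_ge[of y] l by (simp add: mult.commute)
  qed

  obtain \<nu> where \<nu>: "(1 - \<epsilon>) * (\<Prod>p\<in>P y. \<rho> p) \<le> (\<Prod>p\<in>P y. f (p ^ \<nu> p))"
  proof -
    have "\<rho> p > 0" if "p \<in> P y" for p using \<rho>1[of p] that by (simp add: P_def)
    then show ?thesis
      using exists_exponents_near_sup[OF fin \<epsilon>] that unfolding \<rho>_def by blast
  qed
  define a where "a = (\<lambda>p. if p \<le> y then \<nu> p else e p)"
  define n where "n = (\<lambda>x. \<Prod>p\<in>P x. p ^ a p)"
  obtain p0 where p0: "\<And>p. p \<ge> p0 \<Longrightarrow> prime p \<Longrightarrow> 0 < e p \<and> real (e p) \<le> real p powr \<delta>"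
    using subpolynomial_on_primesD[OF e \<delta>] by blast
  have large: "0 < a p" "real (a p) \<le> real p powr \<delta>" if "prime p" "p \<ge> max p0 (Suc y)" for p
    using p0[of p] that by (auto simp: a_def)
  have n_top: "filterlim n at_top sequentially"
    unfolding filterlim_at_top
  proof
    fix B
    obtain q where q: "prime q" "q > max B (max p0 (Suc y))" using bigger_prime[of "max B (max p0 (Suc y))"] by blast
    have "B \<le> n x" if "x \<ge> q" for x
    proof -
      have "q dvd q ^ a q" using large(1)[of q] q by (simp add: dvd_power)
      also have "q ^ a q dvd n x" unfolding n_def using q that by (intro dvd_prodI) (auto simp: P_def)
      finally have "q dvd n x" .
      moreover have "n x > 0" unfolding n_def by (rule prod_pos) (simp add: P_def prime_gt_0_nat)
      ultimately have "q \<le> n x" by (rule dvd_imp_le)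
      then show ?thesis using q by simp
    qed
    then show "\<forall>\<^sub>F x in sequentially. B \<le> n x" by (auto simp: eventually_sequentially)
  qed
  \<comment> \<open>The sum covers the finitely many primes without a growth bound; the leading 1
    gives \<open>K \<ge> 1\<close>, which covers the others.\<close>
  define K where "K = 1 + (\<Sum>p<max p0 (Suc y). real (a p))"
  have "K \<ge> 1" by (simp add: K_def sum_nonneg)
  have a_le: "real (a p) \<le> K * real p powr \<delta>" if p: "prime p" for p
  proof (cases "p < max p0 (Suc y)")
    case True
    then have "real (a p) \<le> K"
      using member_le_sum[of p "{..<max p0 (Suc y)}" "\<lambda>p. real (a p)"] unfolding K_def by simp
    also have "K * 1 \<le> K * real p powr \<delta>"
      using \<open>K \<ge> 1\<close> \<delta> prime_ge_1_nat[OF p] by (intro mult_left_mono ge_one_powr_ge_zero) auto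
    finally show ?thesis by simp
  next
    case False
    then have "real (a p) \<le> 1 * real p powr \<delta>" using large(2)[OF p] by linarith
    also have "\<dots> \<le> K * real p powr \<delta>" using \<open>K \<ge> 1\<close> by (intro mult_right_mono) auto
    finally show ?thesis .
  qed
  have "\<forall>\<^sub>F x in sequentially. ln (ln (real (n x))) \<le> (1 + 2 * \<delta>) * ln (real x)"
    unfolding n_def P_def
    by (rule ln_ln_prod_prime_powers_le[OF a_le])
       (use \<open>K \<ge> 1\<close> \<delta> n_top in \<open>auto simp: n_def P_def\<close>)
  moreover have "(1 - \<epsilon>)\<^sup>2 * (\<Prod>p\<in>P x. \<rho> p) \<le> f (n x)" if "y \<le> x" for x
  proof -
    have "(1 - \<epsilon>)\<^sup>2 * (\<Prod>p\<in>P x. \<rho> p)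
        = ((1 - \<epsilon>) * (\<Prod>p\<in>P y. \<rho> p)) * ((1 - \<epsilon>) * (\<Prod>p\<in>P x - P y. \<rho> p))"
      by (simp add: split[OF that] power2_eq_square)
    also have "\<dots> \<le> (\<Prod>p\<in>P y. f (p ^ \<nu> p)) * ((\<Prod>p\<in>P x - P y. g p) * (\<Prod>p\<in>P x - P y. \<rho> p))"
    proof (rule mult_mono[OF \<nu>])
      have "0 \<le> (\<Prod>p\<in>P x - P y. \<rho> p)"
        using \<rho>0 by (intro prod_nonneg) (auto simp: P_def)
      then show "(1 - \<epsilon>) * (\<Prod>p\<in>P x - P y. \<rho> p)
            \<le> (\<Prod>p\<in>P x - P y. g p) * (\<Prod>p\<in>P x - P y. \<rho> p)"
        and "0 \<le> (1 - \<epsilon>) * (\<Prod>p\<in>P x - P y. \<rho> p)"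
        using tail[OF that] \<epsilon> by (auto intro: mult_right_mono)
      show "0 \<le> (\<Prod>p\<in>P y. f (p ^ \<nu> p))"
        by (intro prod_nonneg) (auto simp: P_def prime_gt_0_nat nonneg)
    qed
    also have "(\<Prod>p\<in>P x - P y. g p) * (\<Prod>p\<in>P x - P y. \<rho> p) = (\<Prod>p\<in>P x - P y. f (p ^ a p))"
      unfolding prod.distrib[symmetric]
    proof (rule prod.cong)
      fix p assume "p \<in> P x - P y"
      then have "prime p" "\<not> p \<le> y" by (auto simp: P_def)
      then show "g p * \<rho> p = f (p ^ a p)" using \<rho>1[of p] by (simp add: g_def a_def)
    qed simp
    also have "(\<Prod>p\<in>P y. f (p ^ \<nu> p)) = (\<Prod>p\<in>P y. f (p ^ a p))"
      by (intro prod.cong) (auto simp: P_def a_def)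
    also have "(\<Prod>p\<in>P y. f (p ^ a p)) * (\<Prod>p\<in>P x - P y. f (p ^ a p)) = (\<Prod>p\<in>P x. f (p ^ a p))"
      by (rule split[OF that, symmetric])
    also have "\<dots> = f (n x)"
      unfolding n_def by (rule multiplicative_fun_prod_prime_powers[OF mult, symmetric]) (auto simp: P_def)
    finally show ?thesis .
  qed
  ultimately show ?thesis
    using n_top unfolding P_def \<rho>_def eventually_sequentially by blast
qed

section \<open>The limsup inequality in the extended reals\<close>

theorem theorem3:
  fixes f :: "nat \<Rightarrow> real" and e :: "nat \<Rightarrow> nat" and R :: ereal
  assumes "multiplicative_fun f"
    and "\<And>n. n > 0 \<Longrightarrow> f n \<ge> 0"
    and "\<And>p. prime p \<Longrightarrow> bdd_above (range (\<lambda>\<nu>::nat. f (p ^ \<nu>)))"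
    and "subpolynomial_on_primes e"
    and "\<exists>L > 0. has_prime_prod (\<lambda>p. f (p ^ e p) * inverse (prime_power_sup f p)) L"
    and "has_prime_prod (\<lambda>p. (1 - 1 / real p) * prime_power_sup f p) R"
  shows "Limsup sequentially (\<lambda>n. ereal (f n / ln (ln (real n)))) \<ge> ereal (exp euler_mascheroni) * R"
proof -
  obtain L where L: "L > 0"
      "has_prime_prod (\<lambda>p. f (p ^ e p) * inverse (prime_power_sup f p)) L"
    using assms(5) by blast
  define lam where "lam = (\<lambda>n. ereal (f n / ln (ln (real n))))"
  have ln_ln_pos: "\<forall>\<^sub>F n::nat in sequentially. 0 < ln (ln (real n))" by real_asymp
  have nonneg: "0 \<le> Limsup sequentially lam"
  proof (rule le_Limsup)
    show "\<forall>\<^sub>F n in sequentially. 0 \<le> lam n"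
      using ln_ln_pos eventually_gt_at_top[of 0] by eventually_elim (simp add: lam_def assms(2))
  qed simp
  \<comment> \<open>Testing against all real \<open>c\<close> below the right side treats finite and
    infinite \<open>R\<close> together; for \<open>c \<le> 0\<close> the nonnegativity of the limsup
    is enough.\<close>
  have ge: "ereal c \<le> Limsup sequentially lam" if c: "ereal c < ereal (exp euler_mascheroni) * R" for c
  proof (cases "c \<le> 0")
    case True
    then show ?thesis using nonneg order_trans[of "ereal c" 0] by simp
  next
    case False
    then have "c > 0" by simp
    have "ereal (c / exp euler_mascheroni) < R"
    proof (cases R)
      case (real r)
      then show ?thesis using c by (simp add: field_simps)
    qed (use c in auto)
    \<comment> \<open>A real number even if \<open>R\<close> is infinite; the partial products of
      \<open>R\<close> eventually exceed it.\<close>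
    then obtain R' where R': "ereal (c / exp euler_mascheroni) < ereal R'" "ereal R' < R"
      using ereal_dense2 by blast
    then have "c < exp euler_mascheroni * R'" by (simp add: field_simps)
    have "0 < c / exp euler_mascheroni" using \<open>c > 0\<close> by simp
    also have "\<dots> < R'" using R'(1) by simp
    finally have "R' > 0" .
    \<comment> \<open>A single \<open>\<epsilon>\<close> pays for all losses: the square for the
      near-extremal values, the difference for Euler's constant, the denominator for
      \<open>ln (ln (n x))\<close>. The limit \<open>R' * exp euler_mascheroni\<close> still exceeds
      \<open>c\<close>.\<close>
    have "((\<lambda>\<epsilon>. (1 - \<epsilon>)\<^sup>2 * (R' * (exp euler_mascheroni - \<epsilon>)) / (1 + 2 * \<epsilon>)) \<longlongrightarrow>
        (1 - 0)\<^sup>2 * (R' * (exp euler_mascheroni - 0)) / (1 + 2 * 0)) (at_right 0)"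
      by (intro tendsto_intros) auto
    then have "\<forall>\<^sub>F \<epsilon> in at_right 0. c < (1 - \<epsilon>)\<^sup>2 * (R' * (exp euler_mascheroni - \<epsilon>)) / (1 + 2 * \<epsilon>)"
      by (rule order_tendstoD) (use \<open>c < exp euler_mascheroni * R'\<close> in \<open>simp add: mult.commute\<close>)
    moreover have "\<forall>\<^sub>F \<epsilon>::real in at_right 0. \<epsilon> \<in> {0<..<1}"
      by (rule eventually_at_right_real) simp
    ultimately have "\<forall>\<^sub>F \<epsilon> in at_right 0.
        c < (1 - \<epsilon>)\<^sup>2 * (R' * (exp euler_mascheroni - \<epsilon>)) / (1 + 2 * \<epsilon>) \<and> \<epsilon> \<in> {0<..<1}"
      by (rule eventually_conj)
    from eventually_happens'[OF trivial_limit_at_right_real this]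
    obtain \<epsilon> where \<epsilon>: "0 < \<epsilon>" "\<epsilon> < 1"
        "c < (1 - \<epsilon>)\<^sup>2 * (R' * (exp euler_mascheroni - \<epsilon>)) / (1 + 2 * \<epsilon>)"
      unfolding greaterThanLessThan_iff by blast
    obtain n where n: "filterlim n at_top sequentially"
      "\<forall>\<^sub>F x in sequentially. (1 - \<epsilon>)\<^sup>2 * (\<Prod>p | prime p \<and> p \<le> x. prime_power_sup f p) \<le> f (n x)"
      "\<forall>\<^sub>F x in sequentially. ln (ln (real (n x))) \<le> (1 + 2 * \<epsilon>) * ln (real x)"
      using exists_near_extremal_sequence[OF assms(1-4) L \<epsilon>(1,2,1)] by blast
    have "\<forall>\<^sub>F x in sequentially. ereal R' < ereal (\<Prod>p | prime p \<and> p \<le> x. (1 - 1 / real p) * prime_power_sup f p)"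
      using assms(6) R'(2) unfolding has_prime_prod_def by (rule order_tendstoD)
    moreover have "\<forall>\<^sub>F x in sequentially. 0 < ln (ln (real (n x)))"
      using ln_ln_pos n(1) by (rule eventually_compose_filterlim)
    \<comment> \<open>The bound on the product over primes is only frequent, so it stands as the
      premise of an implication that holds eventually. The factors \<open>1 - 1/p\<close> of
      \<open>R\<close> cancel against it, leaving the product of the suprema.\<close>
    ultimately have "\<forall>\<^sub>F x in sequentially.
        (exp euler_mascheroni - \<epsilon>) * ln (real x) < (\<Prod>p | prime p \<and> p \<le> x. 1 / (1 - 1 / real p))
        \<longrightarrow> ereal c \<le> lam (n x)"
      using n(2,3) eventually_gt_at_top[of 1]
    proof eventually_elim
      case (elim x)
      let ?A = "{p. prime p \<and> p \<le> x}"
      show ?case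
      proof
        assume M: "(exp euler_mascheroni - \<epsilon>) * ln (real x) < (\<Prod>p\<in>?A. 1 / (1 - 1 / real p))"
        have "ln (real x) > 0" using elim by simp
        have pos: "1 - 1 / real p > 0" if "p \<in> ?A" for p using that prime_gt_1_nat[of p] by simp
        have "c * ((1 + 2 * \<epsilon>) * ln (real x))
            < (1 - \<epsilon>)\<^sup>2 * (R' * ((exp euler_mascheroni - \<epsilon>) * ln (real x)))"
          using mult_strict_right_mono[OF \<epsilon>(3), of "(1 + 2 * \<epsilon>) * ln (real x)"] \<open>ln (real x) > 0\<close> \<epsilon>(1)
          by (simp add: mult.assoc)
        also have "\<dots> \<le> (1 - \<epsilon>)\<^sup>2 * (R' * (\<Prod>p\<in>?A. 1 / (1 - 1 / real p)))"
          using M \<open>R' > 0\<close> by (intro mult_left_mono) auto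
        also have "\<dots> \<le> (1 - \<epsilon>)\<^sup>2 * ((\<Prod>p\<in>?A. (1 - 1 / real p) * prime_power_sup f p) * (\<Prod>p\<in>?A. 1 / (1 - 1 / real p)))"
          using elim pos by (intro mult_left_mono mult_right_mono prod_nonneg) (auto simp: less_imp_le)
        also have "(\<Prod>p\<in>?A. (1 - 1 / real p) * prime_power_sup f p) * (\<Prod>p\<in>?A. 1 / (1 - 1 / real p))
            = (\<Prod>p\<in>?A. prime_power_sup f p)"
          unfolding prod.distrib[symmetric]
        proof (rule prod.cong)
          fix p assume "p \<in> ?A"
          then have "1 - 1 / real p \<noteq> 0" using pos[of p] by linarith
          then show "(1 - 1 / real p) * prime_power_sup f p * (1 / (1 - 1 / real p)) = prime_power_sup f p"
            by (metis mult.commute mult.left_commute mult_1_right nonzero_mult_div_cancel_left times_divide_eq_right)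
        qed simp
        also have "(1 - \<epsilon>)\<^sup>2 * \<dots> \<le> f (n x)" using elim by simp
        finally have "c * ((1 + 2 * \<epsilon>) * ln (real x)) \<le> f (n x)" by simp
        moreover have "c * ln (ln (real (n x))) \<le> c * ((1 + 2 * \<epsilon>) * ln (real x))"
          using elim \<open>c > 0\<close> by (intro mult_left_mono) auto
        ultimately have "c * ln (ln (real (n x))) \<le> f (n x)" by simp
        then show "ereal c \<le> lam (n x)" using elim by (simp add: lam_def field_simps)
      qed
    qed
    moreover have "\<exists>\<^sub>F x in sequentially.
        (exp euler_mascheroni - \<epsilon>) * ln (real x) < (\<Prod>p | prime p \<and> p \<le> x. 1 / (1 - 1 / real p))"
      using \<epsilon>(1) by (intro frequently_prime_prod_gt) simp
    ultimately have freq: "\<exists>\<^sub>F x in sequentially. ereal c \<le> lam (n x)"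
      by (rule frequently_mp)
    \<comment> \<open>As \<open>n x\<close> tends to infinity, an eventual strict upper bound
      \<open>c\<close> for \<open>lam\<close> would carry over to \<open>lam (n x)\<close> and
      contradict \<open>freq\<close>.\<close>
    show ?thesis
    proof (rule ccontr)
      assume "\<not> ?thesis"
      then have "\<forall>\<^sub>F m in sequentially. lam m < ereal c"
        unfolding not_le by (rule Limsup_lessD)
      then have "\<forall>\<^sub>F x in sequentially. lam (n x) < ereal c"
        using n(1) by (rule eventually_compose_filterlim)
      then show False using freq unfolding frequently_def not_le by contradiction
    qed
  qed
  have "ereal (exp euler_mascheroni) * R \<le> Limsup sequentially lam"
  proof (rule ccontr)
    assume "\<not> ?thesis"
    then obtain c where "Limsup sequentially lam < ereal c" "ereal c < ereal (exp euler_mascheroni) * R"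
      unfolding not_le using ereal_dense2 by blast
    then show False using ge[of c] by simp
  qed
  then show ?thesis by (simp add: lam_def)
qed

end
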